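(* Let $P\subset\mathbb{R}^d$ be a polytope, $c\in\mathbb{R}^d$ a generic objective function, and $\eta$ a normalization. There is a polytope $\Pi^{\eta}_{P,c}\subset\mathbb{R}^d$, namely the pivot rule polytope of $(P,c)$ and $\eta$ defined in the context, such that for any generic weights $w,w'\in\mathbb{R}^d$ $$\mathcal{A}^{\eta}_{P,c}(w)=\mathcal{A}^{\eta}_{P,c}(w')\quad\Longleftrightarrow\quad (\Pi^{\eta}_{P,c})^{w}=(\Pi^{\eta}_{P,c})^{w'}.$$
   Context: For a polytope $P\subset\mathbb{R}^d$, $V(P)$ denotes its vertex set and $E(P)$ its edges. A linear function $c\in\mathbb{R}^d$ is generic for $P$ if $c^tu\neq c^tv$ for all edges $uv\in E(P)$; then $c$ has a unique maximizing vertex $v_{opt}$, and $(P,c)$ is called a linear program. $\mathrm{Nb}_{P,c}(v)=\{u : uv\in E(P),\ c^tu>c^tv\}$. A $c$-arborescence is a map $\mathcal{A}:V(P)\to V(P)$ with $\mathcal{A}(v_{opt})=v_{opt}$ and $\mathcal{A}(v)\in \mathrm{Nb}_{P,c}(v)$ for $v\neq v_{opt}$. A normalization is a function $\eta:\mathbb{R}^d\to\mathbb{R}$ with $\eta(u-v)\ne 0$ whenever $u\in\mathrm{Nb}_{P,c}(v)$. A weight $w\in\mathbb{R}^d$ is generic if for every $v\neq v_{opt}$ the maximum of $\frac{w^t(u-v)}{\eta(u-v)}$ over $u\in\mathrm{Nb}_{P,c}(v)$ is attained by a unique $u$; then $\mathcal{A}^\eta_{P,c}(w)$ is the $c$-arborescence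 sending each $v\ne v_{opt}$ to this unique maximizer. For a $c$-arborescence $\mathcal{A}$ put $\psi^\eta(\mathcal{A})=\sum_{v\in V(P)}\frac{\mathcal{A}(v)-v}{\eta(\mathcal{A}(v)-v)}$, with the convention $\frac{0}{\eta(0)}=0$. The pivot rule polytope is $$\Pi^\eta_{P,c}=\operatorname{conv}\{\psi^\eta(\mathcal{A}) : \mathcal{A}\text{ a }c\text{-arborescence of }(P,c)\}.$$ For a polytope $Q\subset\mathbb{R}^d$ and $w\in\mathbb{R}^d$, $Q^w=\{x\in Q : w^tx\ge w^ty\text{ for all }y\in Q\}$ is the face maximizing $w$. *)

theory Defs
  imports "HOL-Analysis.Analysis"
begin

definition vertices :: "'a::euclidean_space set \<Rightarrow> 'a set" where
  "vertices P = {v. v extreme_point_of P}"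

text \<open>An edge \<open>uv\<close> is given by its endpoints. Since \<open>edge_of\<close> demands a face of affine dimension 1,
  \<open>u\<close> and \<open>v\<close> are automatically distinct vertices of \<open>P\<close>.\<close>

definition is_edge :: "'a::euclidean_space set \<Rightarrow> 'a \<Rightarrow> 'a \<Rightarrow> bool" where
  "is_edge P u v \<longleftrightarrow> closed_segment u v edge_of P"

definition generic_objective :: "'a::euclidean_space set \<Rightarrow> 'a \<Rightarrow> bool" where
  "generic_objective P c \<longleftrightarrow> (\<forall>u v. is_edge P u v \<longrightarrow> c \<bullet> u \<noteq> c \<bullet> v)"

definition opt_vertex :: "'a::euclidean_space set \<Rightarrow> 'a \<Rightarrow> 'a" where
  "opt_vertex P c = (THE v. is_arg_max (\<lambda>v. c \<bullet> v) (\<lambda>v. v \<in> vertices P) v)"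

definition improving_neighbors :: "'a::euclidean_space set \<Rightarrow> 'a \<Rightarrow> 'a \<Rightarrow> 'a set" where
  "improving_neighbors P c v = {u. is_edge P u v \<and> c \<bullet> u > c \<bullet> v}"

text \<open>Maps \<open>V(P) \<rightarrow> V(P)\<close> are represented by extensional functions (\<open>\<rightarrow>\<^sub>E\<close>, equal to
  \<open>undefined\<close> outside \<open>V(P)\<close>), so that equality of functions is equality of maps on \<open>V(P)\<close>.\<close>

definition arborescence ::
    "'a::euclidean_space set \<Rightarrow> 'a \<Rightarrow> ('a \<Rightarrow> 'a) \<Rightarrow> bool" where
  "arborescence P c A \<longleftrightarrow>
     A \<in> vertices P \<rightarrow>\<^sub>E vertices P \<and>
     A (opt_vertex P c) = opt_vertex P c \<and>
     (\<forall>v \<in> vertices P - {opt_vertex P c}. A v \<in> improving_neighbors P c v)"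

definition normalization ::
    "'a::euclidean_space set \<Rightarrow> 'a \<Rightarrow> ('a \<Rightarrow> real) \<Rightarrow> bool" where
  "normalization P c \<eta> \<longleftrightarrow>
     (\<forall>v \<in> vertices P. \<forall>u \<in> improving_neighbors P c v. \<eta> (u - v) \<noteq> 0)"

definition best_neighbor ::
    "'a::euclidean_space set \<Rightarrow> 'a \<Rightarrow> ('a \<Rightarrow> real) \<Rightarrow> 'a \<Rightarrow> 'a \<Rightarrow> 'a \<Rightarrow> bool" where
  "best_neighbor P c \<eta> w v u \<longleftrightarrow>
     is_arg_max (\<lambda>u. (w \<bullet> (u - v)) / \<eta> (u - v)) (\<lambda>u. u \<in> improving_neighbors P c v) u"

definition generic_weight ::
    "'a::euclidean_space set \<Rightarrow> 'a \<Rightarrow> ('a \<Rightarrow> real) \<Rightarrow> 'a \<Rightarrow> bool" where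
  "generic_weight P c \<eta> w \<longleftrightarrow>
     (\<forall>v \<in> vertices P - {opt_vertex P c}. \<exists>!u. best_neighbor P c \<eta> w v u)"

definition weight_arborescence ::
    "'a::euclidean_space set \<Rightarrow> 'a \<Rightarrow> ('a \<Rightarrow> real) \<Rightarrow> 'a \<Rightarrow> 'a \<Rightarrow> 'a" where
  "weight_arborescence P c \<eta> w =
     (\<lambda>v \<in> vertices P.
        if v = opt_vertex P c then v else (THE u. best_neighbor P c \<eta> w v u))"

text \<open>The term of \<open>opt_vertex P c\<close> is \<open>0 /\<^sub>R \<eta> 0\<close>, which is \<open>0\<close> for every value of \<open>\<eta> 0\<close>,
  in agreement with the convention \<open>0 / \<eta>(0) = 0\<close>.\<close>

definition arborescence_point ::
    "'a::euclidean_space set \<Rightarrow> ('a \<Rightarrow> real) \<Rightarrow> ('a \<Rightarrow> 'a) \<Rightarrow> 'a" where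
  "arborescence_point P \<eta> A = (\<Sum>v \<in> vertices P. (A v - v) /\<^sub>R \<eta> (A v - v))"

definition pivot_rule_polytope ::
    "'a::euclidean_space set \<Rightarrow> 'a \<Rightarrow> ('a \<Rightarrow> real) \<Rightarrow> 'a set" where
  "pivot_rule_polytope P c \<eta> =
     convex hull {arborescence_point P \<eta> A | A. arborescence P c A}"

definition max_face :: "'a::euclidean_space set \<Rightarrow> 'a \<Rightarrow> 'a set" where
  "max_face Q w = {x \<in> Q. \<forall>y \<in> Q. w \<bullet> x \<ge> w \<bullet> y}"

end

theory Submission
  imports Defs
begin

text \<open>The score \<open>w \<bullet> \<psi>(A)\<close> is a sum over the vertices whose summands can be optimised
  independently. For generic \<open>w\<close> each summand has a unique optimum, so the arborescence of \<open>w\<close> is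
  the only arborescence whose point has maximal score, and the face of \<open>\<Pi>\<close> in direction \<open>w\<close> is
  that single point. Equal faces for \<open>w\<close> and \<open>w'\<close> thus give two arborescences that are both
  \<open>w\<close>-optimal, which have to coincide.\<close>

text \<open>An open half-space stays convex when a single boundary point \<open>x\<close> is added.
  The resulting set contains \<open>T\<close>, hence its hull, so no other point of the hull reaches
  the value at \<open>x\<close>.\<close>

lemma max_face_convex_hull_eq_singleton:
  assumes "x \<in> T" and less: "\<And>y. y \<in> T \<Longrightarrow> y \<noteq> x \<Longrightarrow> w \<bullet> y < w \<bullet> x"
  shows "max_face (convex hull T) w = {x}"
proof -
  have "convex {y. y = x \<or> w \<bullet> y < w \<bullet> x}"
  proof (rule convexI)
    fix y z :: 'a and a b :: real
    assume y: "y \<in> {y. y = x \<or> w \<bullet> y < w \<bullet> x}" and z: "z \<in> {y. y = x \<or> w \<bullet> y < w \<bullet> x}"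
      and ab: "0 \<le> a" "0 \<le> b" "a + b = 1"
    \<comment> \<open>Apart from degenerate combinations, one endpoint lies strictly below
      \<open>x\<close> and carries positive weight, which makes the inequality strict.\<close>
    consider "a = 0" | "b = 0" | "y = x" "z = x"
      | "0 < a" "0 < b" "w \<bullet> y < w \<bullet> x" "w \<bullet> z \<le> w \<bullet> x"
      | "0 < a" "0 < b" "w \<bullet> y \<le> w \<bullet> x" "w \<bullet> z < w \<bullet> x"
      using y z ab by force
    then show "a *\<^sub>R y + b *\<^sub>R z \<in> {y. y = x \<or> w \<bullet> y < w \<bullet> x}"
    proof cases
      case 1
      then show ?thesis using z ab by simp
    next
      case 2
      then show ?thesis using y ab by simp
    next
      case 3
      then show ?thesis using ab by (simp flip: scaleR_add_left)
    next
      case 4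
      then have "a * (w \<bullet> y) + b * (w \<bullet> z) < a * (w \<bullet> x) + b * (w \<bullet> x)"
        by (intro add_less_le_mono mult_strict_left_mono mult_left_mono) auto
      also have "\<dots> = w \<bullet> x" using ab by (simp flip: distrib_right)
      finally show ?thesis by (simp add: inner_add_right)
    next
      case 5
      then have "a * (w \<bullet> y) + b * (w \<bullet> z) < a * (w \<bullet> x) + b * (w \<bullet> x)"
        by (intro add_le_less_mono mult_strict_left_mono mult_left_mono) auto
      also have "\<dots> = w \<bullet> x" using ab by (simp flip: distrib_right)
      finally show ?thesis by (simp add: inner_add_right)
    qed
  qed
  then have "convex hull T \<subseteq> {y. y = x \<or> w \<bullet> y < w \<bullet> x}"
    using less by (intro hull_minimal) auto
  moreover have "x \<in> convex hull T"
    using assms(1) by (rule hull_inc)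
  ultimately show ?thesis
    unfolding max_face_def by force
qed

lemma finite_vertices: "polytope P \<Longrightarrow> finite (vertices P)"
  unfolding vertices_def by (simp add: finite_polyhedron_extreme_points polytope_imp_polyhedron)

lemma is_edge_imp_vertex:
  assumes "is_edge P u v"
  shows "u \<in> vertices P"
proof -
  have "closed_segment u v face_of P"
    using assms unfolding is_edge_def edge_of_def by simp
  then show ?thesis
    using extreme_point_of_face[of _ P u] extreme_point_of_segment[of u u v]
    unfolding vertices_def by simp
qed

lemma improving_neighbors_subset_vertices: "improving_neighbors P c v \<subseteq> vertices P"
  unfolding improving_neighbors_def using is_edge_imp_vertex by auto

lemma finite_arborescences:
  assumes "polytope P"
  shows "finite {A. arborescence P c A}"
proof (rule finite_subset)
  \<comment> \<open>Extensionality is essential here: values left free outside the vertices would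
    give infinitely many maps.\<close>
  show "finite (vertices P \<rightarrow>\<^sub>E vertices P)"
    using assms by (simp add: finite_PiE finite_vertices)
qed (auto simp: arborescence_def)

lemma polytope_pivot_rule_polytope:
  assumes "polytope P"
  shows "polytope (pivot_rule_polytope P c \<eta>)"
  unfolding pivot_rule_polytope_def using finite_arborescences[OF assms]
  by (intro polytope_convex_hull) auto

text \<open>A \<open>c\<close>-maximal vertex has no improving neighbour, so genericity of \<open>w\<close> alone forces it to be
  \<open>opt_vertex P c\<close>, without knowing in advance that the defining \<open>THE\<close> is well posed.\<close>

lemma opt_vertex_in_vertices:
  assumes "polytope P" and "vertices P \<noteq> {}" and "generic_weight P c \<eta> w"
  shows "opt_vertex P c \<in> vertices P"
proof -
  obtain v where v: "v \<in> vertices P" "\<And>u. u \<in> vertices P \<Longrightarrow> c \<bullet> u \<le> c \<bullet> v"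
    using ex_is_arg_min_if_finite[OF finite_vertices[OF assms(1)] assms(2), of "\<lambda>v. - (c \<bullet> v)"]
    by (auto simp: is_arg_min_linorder)
  have "improving_neighbors P c v = {}"
    using v(2) is_edge_imp_vertex unfolding improving_neighbors_def by fastforce
  then have "v = opt_vertex P c"
    using assms(3) v(1) unfolding generic_weight_def best_neighbor_def is_arg_max_def by blast
  with v(1) show ?thesis by simp
qed

text \<open>A second neighbor with an equal score would be a maximizer too, so uniqueness turns the
  weak inequality into a strict one.\<close>

lemma best_neighbor_less:
  assumes "\<exists>!u. best_neighbor P c \<eta> w v u" and "best_neighbor P c \<eta> w v u"
    and "x \<in> improving_neighbors P c v" and "x \<noteq> u"
  shows "(w \<bullet> (x - v)) / \<eta> (x - v) < (w \<bullet> (u - v)) / \<eta> (u - v)"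
  using assms unfolding best_neighbor_def is_arg_max_def by (metis linorder_less_linear)

lemma best_neighbor_weight_arborescence:
  assumes "generic_weight P c \<eta> w" and "v \<in> vertices P" and "v \<noteq> opt_vertex P c"
  shows "best_neighbor P c \<eta> w v (weight_arborescence P c \<eta> w v)"
  using assms theI'[of "best_neighbor P c \<eta> w v"]
  by (simp add: generic_weight_def weight_arborescence_def)

lemma arborescence_weight_arborescence:
  assumes "polytope P" and "vertices P \<noteq> {}" and "generic_weight P c \<eta> w"
  shows "arborescence P c (weight_arborescence P c \<eta> w)"
proof -
  let ?A = "weight_arborescence P c \<eta> w"
  have opt: "opt_vertex P c \<in> vertices P"
    using assms by (rule opt_vertex_in_vertices)
  \<comment> \<open>Membership of the optimum in \<open>vertices P\<close> matters: the restriction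
    is \<open>undefined\<close> elsewhere.\<close>
  then have A_opt: "?A (opt_vertex P c) = opt_vertex P c"
    by (simp add: weight_arborescence_def)
  have nb: "?A v \<in> improving_neighbors P c v" if "v \<in> vertices P" "v \<noteq> opt_vertex P c" for v
    using best_neighbor_weight_arborescence[OF assms(3) that]
    unfolding best_neighbor_def is_arg_max_def by simp
  have "?A v \<in> vertices P" if "v \<in> vertices P" for v
    using A_opt opt nb that improving_neighbors_subset_vertices[of P c v] by fastforce
  then have "?A \<in> vertices P \<rightarrow>\<^sub>E vertices P"
    by (simp add: weight_arborescence_def restrict_PiE_iff)
  with A_opt nb show ?thesis
    by (simp add: arborescence_def)
qed

lemma inner_arborescence_point:
  "w \<bullet> arborescence_point P \<eta> A =
    (\<Sum>v \<in> vertices P. (w \<bullet> (A v - v)) / \<eta> (A v - v))"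
  unfolding arborescence_point_def
  by (simp add: inner_sum_right divide_inverse mult.commute)

text \<open>The sums are compared vertex by vertex: \<open>A\<close> never gains, and it loses
  strictly wherever it deviates. Distinctness is assumed of the maps, not of their points, so
  different arborescences cannot share the optimal point.\<close>

lemma inner_arborescence_point_less:
  assumes "polytope P" and gen: "generic_weight P c \<eta> w"
    and A: "arborescence P c A" and ne: "A \<noteq> weight_arborescence P c \<eta> w"
  shows "w \<bullet> arborescence_point P \<eta> A
    < w \<bullet> arborescence_point P \<eta> (weight_arborescence P c \<eta> w)"
proof -
  let ?B = "weight_arborescence P c \<eta> w"
  let ?f = "\<lambda>A v. (w \<bullet> (A v - v)) / \<eta> (A v - v)"
  have B_opt: "A v = ?B v" if "v \<in> vertices P" "v = opt_vertex P c" for v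
    using A that by (simp add: arborescence_def weight_arborescence_def)
  have less: "?f A v < ?f ?B v" if "v \<in> vertices P" "A v \<noteq> ?B v" for v
  proof (rule best_neighbor_less)
    have "v \<noteq> opt_vertex P c"
      using B_opt that by blast
    with gen A that show "\<exists>!u. best_neighbor P c \<eta> w v u" "best_neighbor P c \<eta> w v (?B v)"
      "A v \<in> improving_neighbors P c v" "A v \<noteq> ?B v"
      using best_neighbor_weight_arborescence[OF gen]
      by (simp_all add: generic_weight_def arborescence_def)
  qed
  have "\<exists>v \<in> vertices P. A v \<noteq> ?B v"
  proof (rule ccontr)
    assume "\<not> ?thesis"
    moreover have "A \<in> extensional (vertices P)" "?B \<in> extensional (vertices P)"
      using A by (auto simp: arborescence_def PiE_def weight_arborescence_def)
    ultimately have "A = ?B"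
      by (intro extensionalityI) auto
    with ne show False ..
  qed
  moreover have "?f A v \<le> ?f ?B v" if "v \<in> vertices P" for v
    using less[OF that] by (cases "A v = ?B v") auto
  ultimately have "sum (?f A) (vertices P) < sum (?f ?B) (vertices P)"
    using less finite_vertices[OF assms(1)] by (intro sum_strict_mono_ex1) auto
  then show ?thesis
    by (simp only: inner_arborescence_point)
qed

lemma max_face_pivot_rule_polytope:
  assumes "polytope P" and "vertices P \<noteq> {}" and "generic_weight P c \<eta> w"
  shows "max_face (pivot_rule_polytope P c \<eta>) w
    = {arborescence_point P \<eta> (weight_arborescence P c \<eta> w)}"
  unfolding pivot_rule_polytope_def
  using arborescence_weight_arborescence[OF assms]
    inner_arborescence_point_less[OF assms(1,3)]
  by (intro max_face_convex_hull_eq_singleton) auto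

text \<open>For \<open>P = {}\<close> the value \<open>opt_vertex P c\<close> is junk and there may be no arborescence at all.\<close>

lemma max_face_pivot_rule_polytope_no_vertices:
  assumes "vertices P = {}"
  shows "max_face (pivot_rule_polytope P c \<eta>) w = pivot_rule_polytope P c \<eta>"
proof -
  have "pivot_rule_polytope P c \<eta> \<subseteq> {0}"
    unfolding pivot_rule_polytope_def
    by (intro hull_minimal) (auto simp: arborescence_point_def assms)
  then show ?thesis
    unfolding max_face_def by auto
qed

theorem theorem1p4:
  fixes P :: "'a::euclidean_space set" and c :: 'a and \<eta> :: "'a \<Rightarrow> real"
  assumes "polytope P"
    and "generic_objective P c"
    and "normalization P c \<eta>"
  shows "polytope (pivot_rule_polytope P c \<eta>) \<and>
    (\<forall>w w'. generic_weight P c \<eta> w \<longrightarrow> generic_weight P c \<eta> w' \<longrightarrow>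
       (weight_arborescence P c \<eta> w = weight_arborescence P c \<eta> w' \<longleftrightarrow>
        max_face (pivot_rule_polytope P c \<eta>) w = max_face (pivot_rule_polytope P c \<eta>) w'))"
proof (intro conjI allI impI)
  show "polytope (pivot_rule_polytope P c \<eta>)"
    using assms(1) by (rule polytope_pivot_rule_polytope)
next
  fix w w'
  assume w: "generic_weight P c \<eta> w" and w': "generic_weight P c \<eta> w'"
  let ?A = "weight_arborescence P c \<eta> w" and ?A' = "weight_arborescence P c \<eta> w'"
  show "?A = ?A' \<longleftrightarrow>
    max_face (pivot_rule_polytope P c \<eta>) w = max_face (pivot_rule_polytope P c \<eta>) w'"
  proof (cases "vertices P = {}")
    case True
    then show ?thesis
      \<comment> \<open>Both sides hold: the two maps are \<open>undefined\<close> everywhere, and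
        each face is the whole polytope.\<close>
      by (simp add: max_face_pivot_rule_polytope_no_vertices weight_arborescence_def restrict_def)
  next
    case False
    \<comment> \<open>If \<open>?A'\<close> differed from \<open>?A\<close>, its score under
      \<open>w\<close> would be strictly smaller, although the points coincide.\<close>
    have "?A = ?A'" if "arborescence_point P \<eta> ?A = arborescence_point P \<eta> ?A'"
      using inner_arborescence_point_less[OF assms(1) w
          arborescence_weight_arborescence[OF assms(1) False w']] that
      by fastforce
    then show ?thesis
      using max_face_pivot_rule_polytope[OF assms(1) False] w w' by auto
  qed
qed

end
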